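(* Let $\mathcal{A}$ be a real central hyperplane arrangement, let $c$ be a chamber of $\mathcal{A}$ and let $X$ be an intersection subspace of $\mathcal{A}$. Then $c$ is incident to $X$ if and only if for every intersection subspace $Y$ of $\mathcal{A}_X$ such that $c_X$ is incident to $Y$ (in the arrangement $\mathcal{A}_X$), there exists a chamber $c'$ of $\mathcal{A}$ with $S(c,c')=\mathcal{A}_Y$.
   Context: $\mathcal{A}$ is a finite set of linear hyperplanes in $\mathbb{R}^n$; chambers are the connected components of the complement of their union. An intersection subspace is an intersection of a subset of hyperplanes of the arrangement. For an intersection subspace $Z$, $\mathcal{A}_Z=\{H\in\mathcal{A}:H\supseteq Z\}$. For a chamber $c$ of $\mathcal{A}$, $c_X$ denotes the chamber of $\mathcal{A}_X$ containing $c$. $S(c,c')$ is the set of hyperplanes separating chambers $c$ and $c'$. A chamber $d$ of an arrangement is incident to an intersection subspace $Z$ of that arrangement if $\overline{d}\cap Z$ spans $Z$ (equivalently, $\overline{d}$ has a face whose linear span is $Z$). *)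

theory Defs
  imports "HOL-Analysis.Analysis"
begin

definition linear_hyperplane :: "(real ^ 'n) set \<Rightarrow> bool" where
  "linear_hyperplane H \<longleftrightarrow> (\<exists>a. a \<noteq> 0 \<and> H = {x. a \<bullet> x = 0})"

definition central_arrangement :: "(real ^ 'n) set set \<Rightarrow> bool" where
  "central_arrangement A \<longleftrightarrow> finite A \<and> (\<forall>H\<in>A. linear_hyperplane H)"

definition chambers :: "(real ^ 'n) set set \<Rightarrow> (real ^ 'n) set set" where
  "chambers A = components (- \<Union>A)"

text \<open>The empty subfamily is allowed; since \<open>\<Inter>{} = UNIV\<close>, the whole space is an
  intersection subspace of every arrangement.\<close>

definition intersection_subspaces :: "(real ^ 'n) set set \<Rightarrow> (real ^ 'n) set set" where
  "intersection_subspaces A = {\<Inter>B | B. B \<subseteq> A}"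

definition localization :: "(real ^ 'n) set set \<Rightarrow> (real ^ 'n) set \<Rightarrow> (real ^ 'n) set set" where
  "localization A Z = {H \<in> A. Z \<subseteq> H}"

text \<open>The chamber \<open>c\<^sub>Z\<close>. It is well defined when \<open>c\<close> is a chamber of \<open>A\<close>: then \<open>c\<close> is
  nonempty, connected and disjoint from all hyperplanes of \<open>localization A Z\<close>.\<close>

definition localized_chamber ::
    "(real ^ 'n) set set \<Rightarrow> (real ^ 'n) set \<Rightarrow> (real ^ 'n) set \<Rightarrow> (real ^ 'n) set" where
  "localized_chamber A Z c = (THE d. d \<in> chambers (localization A Z) \<and> c \<subseteq> d)"

text \<open>The two sets lie in opposite open half-spaces bounded by \<open>H\<close>; replacing the normal
  vector \<open>a\<close> by \<open>- a\<close> shows that this is symmetric in \<open>c\<close> and \<open>c'\<close>.\<close>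

definition separates :: "(real ^ 'n) set \<Rightarrow> (real ^ 'n) set \<Rightarrow> (real ^ 'n) set \<Rightarrow> bool" where
  "separates H c c' \<longleftrightarrow>
     (\<exists>a. a \<noteq> 0 \<and> H = {x. a \<bullet> x = 0} \<and> (\<forall>x\<in>c. a \<bullet> x > 0) \<and> (\<forall>x\<in>c'. a \<bullet> x < 0))"

definition separating_set ::
    "(real ^ 'n) set set \<Rightarrow> (real ^ 'n) set \<Rightarrow> (real ^ 'n) set \<Rightarrow> (real ^ 'n) set set" where
  "separating_set A c c' = {H \<in> A. separates H c c'}"

definition incident :: "(real ^ 'n) set \<Rightarrow> (real ^ 'n) set \<Rightarrow> bool" where
  "incident d Z \<longleftrightarrow> span (closure d \<inter> Z) = Z"

end

theory Submission
  imports Defs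
begin

text \<open>Orient the normals \<open>a\<close> so that \<open>c\<close> is the set where all of them are positive. Then \<open>c\<close> is
  incident to \<open>X\<close> iff \<open>X\<close> contains a point \<open>x\<close> with \<open>a i \<bullet> x > 0\<close> for every hyperplane not
  containing \<open>X\<close>. Given such a point and a generic point \<open>y\<close> of a face of \<open>c\<^sub>X\<close> spanning \<open>Y\<close>, the
  point \<open>x + \<epsilon> y - \<delta> p\<close> with \<open>p \<in> c\<close> lies in the required chamber \<open>c'\<close>.

  Conversely, the faces of \<open>c\<^sub>X\<close> are treated in order of increasing codimension. Let \<open>C\<close> be the open
  cone where the normals of the hyperplanes not containing \<open>Y\<close> are positive. If all faces of
  \<open>c\<^sub>Y\<close> larger than \<open>Y\<close> meet \<open>C\<close> in their relative interior, then every point of the closure of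
  \<open>c\<^sub>Y\<close> outside \<open>Y\<close> can be moved into \<open>C\<close> by a translation along \<open>Y\<close>: subtract from it
  points of \<open>C\<close> in smaller and smaller faces until it lies in \<open>Y\<close>. For \<open>q\<close> in the chamber \<open>c'\<close> with
  \<open>S(c,c') = A\<^sub>Y\<close>, the point \<open>-q\<close> is in \<open>c\<^sub>Y\<close>, so \<open>x - q \<in> C\<close> for some \<open>x \<in> Y\<close>; since also
  \<open>q \<in> C\<close>, it follows that \<open>x \<in> C\<close>.\<close>

section \<open>Systems of linear inequalities\<close>

text \<open>The index set is a separate argument so that one choice of normals serves an
  arrangement, its localizations and their complements alike. For empty \<open>I\<close> the cone is
  the whole space.\<close>

definition pos_cone :: "('i \<Rightarrow> 'a::real_inner) \<Rightarrow> 'i set \<Rightarrow> 'a set" where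
  "pos_cone a I = {x. \<forall>i\<in>I. a i \<bullet> x > 0}"

lemma convex_pos_cone: "convex (pos_cone a I)"
proof -
  have "pos_cone a I = (\<Inter>i\<in>I. {x. a i \<bullet> x > 0})"
    by (auto simp: pos_cone_def)
  then show ?thesis
    by (auto intro!: convex_INT convex_halfspace_gt)
qed

lemma pos_cone_add_scaled:
  assumes "x \<in> pos_cone a I" "z \<in> pos_cone a I" "s > 0"
  shows "x + s *\<^sub>R z \<in> pos_cone a I"
  using assms by (auto simp: pos_cone_def inner_add_right intro!: add_pos_pos)

lemma pos_cone_perturb:
  assumes "finite I" "x \<in> pos_cone a I"
  obtains e :: real where "e > 0" "x + e *\<^sub>R y \<in> pos_cone a I"
proof -
  have "\<forall>\<^sub>F e in at_right (0::real). a i \<bullet> (x + e *\<^sub>R y) > 0" if "i \<in> I" for i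
  proof -
    have "((\<lambda>e::real. a i \<bullet> (x + e *\<^sub>R y)) \<longlongrightarrow> a i \<bullet> (x + 0 *\<^sub>R y)) (at_right 0)"
      by (intro tendsto_intros)
    then show ?thesis
      using assms that by (intro order_tendstoD(1)) (auto simp: pos_cone_def)
  qed
  then have "\<forall>\<^sub>F e in at_right (0::real). \<forall>i\<in>I. a i \<bullet> (x + e *\<^sub>R y) > 0"
    using assms(1) by (simp add: eventually_ball_finite)
  then have "\<forall>\<^sub>F e in at_right (0::real). 0 < e \<and> (\<forall>i\<in>I. a i \<bullet> (x + e *\<^sub>R y) > 0)"
    using eventually_at_right_less by (rule eventually_conj[rotated])
  then have "\<exists>e::real. 0 < e \<and> (\<forall>i\<in>I. a i \<bullet> (x + e *\<^sub>R y) > 0)"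
    by (rule eventually_happens'[rotated]) simp
  then show thesis
    using that by (auto simp: pos_cone_def)
qed

text \<open>Adding a small multiple of \<open>p\<close> makes all weak inequalities strict. Some
  such \<open>p\<close> must exist: an empty cone has empty closure, while the right-hand side
  always contains 0.\<close>

lemma closure_pos_cone:
  assumes "p \<in> pos_cone a I"
  shows "closure (pos_cone a I) = {x. \<forall>i\<in>I. a i \<bullet> x \<ge> 0}"
proof
  have "{x. \<forall>i\<in>I. a i \<bullet> x \<ge> 0} = (\<Inter>i\<in>I. {x. a i \<bullet> x \<ge> 0})"
    by auto
  then have "closed {x. \<forall>i\<in>I. a i \<bullet> x \<ge> 0}"
    by (auto intro!: closed_INT closed_halfspace_ge)
  then show "closure (pos_cone a I) \<subseteq> {x. \<forall>i\<in>I. a i \<bullet> x \<ge> 0}"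
    by (rule closure_minimal[rotated]) (auto simp: pos_cone_def less_imp_le)
next
  show "{x. \<forall>i\<in>I. a i \<bullet> x \<ge> 0} \<subseteq> closure (pos_cone a I)"
  proof
    fix x assume x: "x \<in> {x. \<forall>i\<in>I. a i \<bullet> x \<ge> 0}"
    let ?f = "\<lambda>n. x + inverse (real (Suc n)) *\<^sub>R p"
    have "?f n \<in> pos_cone a I" for n
      using x assms by (auto simp: pos_cone_def inner_add_right intro!: add_nonneg_pos)
    moreover have "?f \<longlonglongrightarrow> x + 0 *\<^sub>R p"
      by (intro tendsto_intros LIMSEQ_inverse_real_of_nat)
    ultimately show "x \<in> closure (pos_cone a I)"
      unfolding closure_sequential by (intro exI[of _ ?f]) simp
  qed
qed

section \<open>Moving between the faces of a polyhedral cone\<close>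

text \<open>The ratio test of linear programming. The point \<open>z\<close> lies in the relative
  interior of the same face as \<open>y\<close>, so walking from \<open>y\<close> in direction
  \<open>-z\<close> keeps the tight constraints tight, and the walk can stop when the first further
  constraint becomes tight.\<close>

lemma ray_exits_cone:
  fixes a :: "'i \<Rightarrow> 'a::real_inner"
  assumes "finite E" "\<forall>i\<in>E. a i \<bullet> y \<ge> 0" "\<exists>i\<in>E. a i \<bullet> y \<noteq> 0"
    and z: "\<forall>i\<in>E. a i \<bullet> z \<ge> 0 \<and> (a i \<bullet> z = 0 \<longleftrightarrow> a i \<bullet> y = 0)"
  obtains s where "s > 0" "\<forall>i\<in>E. a i \<bullet> (y - s *\<^sub>R z) \<ge> 0"
    "{i\<in>E. a i \<bullet> (y - s *\<^sub>R z) \<noteq> 0} \<subset> {i\<in>E. a i \<bullet> y \<noteq> 0}"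
proof -
  let ?P = "{i\<in>E. a i \<bullet> y \<noteq> 0}"
  let ?r = "\<lambda>i. (a i \<bullet> y) / (a i \<bullet> z)"
  have P: "finite ?P" "?P \<noteq> {}"
    using assms by auto
  \<comment> \<open>The first parameter at which a constraint positive at \<open>y\<close> reaches
    0; its minimizer \<open>i\<close> is the constraint that leaves the set.\<close>
  define s where "s = Min (?r ` ?P)"
  have "s \<in> ?r ` ?P"
    unfolding s_def using P by (intro Min_in) auto
  then obtain i where i: "i \<in> ?P" "s = ?r i" by blast
  have pos: "a j \<bullet> y > 0 \<and> a j \<bullet> z > 0" if "j \<in> ?P" for j
    using that assms(2) z by (simp add: order_less_le)
  have s_pos: "s > 0"
    using i pos[of i] by simp
  have "a j \<bullet> (y - s *\<^sub>R z) \<ge> 0" if "j \<in> E" for j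
  proof (cases "j \<in> ?P")
    case True
    then have "s \<le> ?r j"
      unfolding s_def using P by (intro Min_le) auto
    then show ?thesis
      using pos[OF True] by (simp add: inner_diff_right pos_le_divide_eq)
  next
    case False
    then have "a j \<bullet> y = 0" "a j \<bullet> z = 0"
      using that z by auto
    then show ?thesis
      by (simp add: inner_diff_right)
  qed
  then have nonneg: "\<forall>j\<in>E. a j \<bullet> (y - s *\<^sub>R z) \<ge> 0"
    by blast
  have "a i \<bullet> (y - s *\<^sub>R z) = 0"
    using i pos[of i] by (simp add: inner_diff_right)
  moreover have "a j \<bullet> (y - s *\<^sub>R z) = 0" if "j \<in> E" "a j \<bullet> y = 0" for j
    using that z by (simp add: inner_diff_right)
  ultimately have "{i\<in>E. a i \<bullet> (y - s *\<^sub>R z) \<noteq> 0} \<subset> ?P"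
    using i(1) by blast
  with s_pos nonneg show thesis
    using that by blast
qed

text \<open>Induction on the number of constraints that are positive at \<open>y\<close>: each
  subtraction of a point of the cone moves to a smaller face, and the subtracted points are added
  back at the end.\<close>

lemma translate_into_pos_cone:
  fixes a :: "'i \<Rightarrow> 'a::real_inner"
  assumes "finite E"
    and faces: "\<And>y. \<lbrakk>\<forall>i\<in>E. a i \<bullet> y \<ge> 0; \<exists>i\<in>E. a i \<bullet> y \<noteq> 0\<rbrakk> \<Longrightarrow>
      \<exists>z\<in>pos_cone a B. \<forall>i\<in>E. a i \<bullet> z \<ge> 0 \<and> (a i \<bullet> z = 0 \<longleftrightarrow> a i \<bullet> y = 0)"
    and "\<forall>i\<in>E. a i \<bullet> y \<ge> 0" "\<exists>i\<in>E. a i \<bullet> y \<noteq> 0"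
  shows "\<exists>x. (\<forall>i\<in>E. a i \<bullet> x = 0) \<and> y + x \<in> pos_cone a B"
  using assms(3,4)
proof (induction "card {i\<in>E. a i \<bullet> y \<noteq> 0}" arbitrary: y rule: less_induct)
  case less
  obtain z where z: "z \<in> pos_cone a B"
      "\<forall>i\<in>E. a i \<bullet> z \<ge> 0 \<and> (a i \<bullet> z = 0 \<longleftrightarrow> a i \<bullet> y = 0)"
    using faces[OF less.prems] by blast
  obtain s where s: "s > 0" "\<forall>i\<in>E. a i \<bullet> (y - s *\<^sub>R z) \<ge> 0"
      "{i\<in>E. a i \<bullet> (y - s *\<^sub>R z) \<noteq> 0} \<subset> {i\<in>E. a i \<bullet> y \<noteq> 0}"
    using ray_exits_cone[OF \<open>finite E\<close> less.prems z(2)] .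
  show ?case
  proof (cases "\<exists>i\<in>E. a i \<bullet> (y - s *\<^sub>R z) \<noteq> 0")
    case True
    have "card {i\<in>E. a i \<bullet> (y - s *\<^sub>R z) \<noteq> 0} < card {i\<in>E. a i \<bullet> y \<noteq> 0}"
      using s(3) \<open>finite E\<close> by (intro psubset_card_mono) auto
    from less.hyps[OF this s(2) True] obtain x
      where x: "\<forall>i\<in>E. a i \<bullet> x = 0" "y - s *\<^sub>R z + x \<in> pos_cone a B" by blast
    have "y + x \<in> pos_cone a B"
      using pos_cone_add_scaled[OF x(2) z(1) s(1)] by (simp add: algebra_simps)
    with x show ?thesis by blast
  next
    case False
    \<comment> \<open>The rest of \<open>y\<close> after the subtraction is killed by all of
      \<open>E\<close>, so its negative is an admissible translation; it leaves a positive multiple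
      of \<open>z\<close>.\<close>
    have "y + (s *\<^sub>R z - y) \<in> pos_cone a B"
      using z(1) s(1) by (simp add: pos_cone_def)
    moreover have "\<forall>i\<in>E. a i \<bullet> (s *\<^sub>R z - y) = 0"
      using False by (simp add: inner_diff_right)
    ultimately show ?thesis by blast
  qed
qed

text \<open>The converse direction in terms of inequalities: \<open>J\<close> plays the role of the
  localization at \<open>X\<close>, and \<open>y\<close> marks a face of its cone by its set of
  zeros. Induction on the number of zeros treats larger faces first.\<close>

lemma generic_face_point:
  fixes a :: "'i \<Rightarrow> 'a::real_inner"
  assumes "finite I" "J \<subseteq> I"
    and opposite: "\<And>y. \<forall>i\<in>J. a i \<bullet> y \<ge> 0 \<Longrightarrow>
      \<exists>q\<in>pos_cone a (I - {i\<in>J. a i \<bullet> y = 0}). \<forall>i\<in>J. a i \<bullet> y = 0 \<longrightarrow> a i \<bullet> q < 0"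
    and "\<forall>i\<in>J. a i \<bullet> y \<ge> 0"
  shows "\<exists>x\<in>pos_cone a (I - {i\<in>J. a i \<bullet> y = 0}). \<forall>i\<in>J. a i \<bullet> y = 0 \<longrightarrow> a i \<bullet> x = 0"
  using assms(4)
proof (induction "card {i\<in>J. a i \<bullet> y = 0}" arbitrary: y rule: less_induct)
  case less
  define E where "E = {i\<in>J. a i \<bullet> y = 0}"
  have fin: "finite J" "finite E"
    using finite_subset[OF assms(2,1)] by (auto simp: E_def)
  obtain q where q: "q \<in> pos_cone a (I - E)" "\<forall>i\<in>E. a i \<bullet> q < 0"
    using opposite[OF less.prems] by (auto simp: E_def)
  show ?case
  proof (cases "E = {}")
    case True
    with q show ?thesis by (auto simp: E_def)
  next
    case False
    have faces: "\<exists>z\<in>pos_cone a (I - E). \<forall>i\<in>E. a i \<bullet> z \<ge> 0 \<and> (a i \<bullet> z = 0 \<longleftrightarrow> a i \<bullet> v = 0)"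
      if v: "\<forall>i\<in>E. a i \<bullet> v \<ge> 0" "\<exists>i\<in>E. a i \<bullet> v \<noteq> 0" for v
    proof -
      \<comment> \<open>For small \<open>e\<close> the point \<open>y + e v\<close> is still
        positive off \<open>E\<close>, and on \<open>E\<close> it has the signs of \<open>v\<close>.
        It marks a face with fewer zeros, to which the induction hypothesis applies.\<close>
      have "y \<in> pos_cone a (J - E)"
        using less.prems by (auto simp: pos_cone_def E_def order_less_le)
      then obtain e where e: "e > 0" "y + e *\<^sub>R v \<in> pos_cone a (J - E)"
        using pos_cone_perturb[of "J - E"] fin by blast
      have on_E: "a i \<bullet> (y + e *\<^sub>R v) = e * (a i \<bullet> v)" if "i \<in> E" for i
        using that by (simp add: E_def inner_add_right)
      have nonneg: "\<forall>i\<in>J. a i \<bullet> (y + e *\<^sub>R v) \<ge> 0"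
      proof
        fix i assume "i \<in> J"
        then show "a i \<bullet> (y + e *\<^sub>R v) \<ge> 0"
          using e v on_E[of i] by (cases "i \<in> E") (auto simp: pos_cone_def less_imp_le)
      qed
      have zeros: "{i\<in>J. a i \<bullet> (y + e *\<^sub>R v) = 0} = {i\<in>E. a i \<bullet> v = 0}"
      proof (intro set_eqI iffI)
        fix i assume i: "i \<in> {i\<in>J. a i \<bullet> (y + e *\<^sub>R v) = 0}"
        then have "i \<in> E"
          using e(2) by (force simp: pos_cone_def)
        with i on_E[of i] e(1) show "i \<in> {i\<in>E. a i \<bullet> v = 0}" by simp
      next
        fix i assume "i \<in> {i\<in>E. a i \<bullet> v = 0}"
        with on_E[of i] show "i \<in> {i\<in>J. a i \<bullet> (y + e *\<^sub>R v) = 0}" by (simp add: E_def)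
      qed
      have "card {i\<in>J. a i \<bullet> (y + e *\<^sub>R v) = 0} < card {i\<in>J. a i \<bullet> y = 0}"
        unfolding zeros E_def[symmetric] using v(2) fin by (intro psubset_card_mono) auto
      from less.hyps[OF this nonneg] obtain z where z:
        "z \<in> pos_cone a (I - {i\<in>E. a i \<bullet> v = 0})"
        "\<forall>i\<in>E. a i \<bullet> v = 0 \<longrightarrow> a i \<bullet> z = 0"
        unfolding zeros by (metis (mono_tags, lifting) mem_Collect_eq zeros)
      have "z \<in> pos_cone a (I - E)"
        using z(1) by (auto simp: pos_cone_def)
      moreover have "a i \<bullet> z \<ge> 0 \<and> (a i \<bullet> z = 0 \<longleftrightarrow> a i \<bullet> v = 0)" if "i \<in> E" for i
      proof -
        have "i \<in> I" using that assms(2) by (auto simp: E_def)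
        then have "a i \<bullet> z > 0" if "a i \<bullet> v \<noteq> 0"
          using z(1) that by (simp add: pos_cone_def)
        with z(2) that show ?thesis
          by (cases "a i \<bullet> v = 0") auto
      qed
      ultimately show ?thesis by blast
    qed
    \<comment> \<open>All of \<open>E\<close> is positive at \<open>-q\<close>, and \<open>E\<close>
      is nonempty, so \<open>-q\<close> is a legitimate point to translate.\<close>
    obtain x where x: "\<forall>i\<in>E. a i \<bullet> x = 0" "- q + x \<in> pos_cone a (I - E)"
      using translate_into_pos_cone[OF fin(2) faces, where y = "- q"] q(2) False
      by (auto simp: less_imp_le less_imp_neq)
    have "x \<in> pos_cone a (I - E)"
      using pos_cone_add_scaled[OF x(2) q(1), of 1] by simp
    with x(1) show ?thesis by (auto simp: E_def)
  qed
qed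

text \<open>The signs are decided in three stages: by \<open>x\<close> outside \<open>J\<close>, by
  \<open>y\<close> on \<open>J - E\<close> where \<open>x\<close> vanishes, and by \<open>-p\<close>
  on \<open>E\<close> where both vanish. Each later term is scaled to preserve the signs already
  fixed.\<close>

lemma opposite_point:
  assumes "finite I" "J \<subseteq> I" "E \<subseteq> J"
    and p: "p \<in> pos_cone a I"
    and x: "x \<in> pos_cone a (I - J)" "\<forall>i\<in>J. a i \<bullet> x = 0"
    and y: "y \<in> pos_cone a (J - E)" "\<forall>i\<in>E. a i \<bullet> y = 0"
  shows "\<exists>q\<in>pos_cone a (I - E). \<forall>i\<in>E. a i \<bullet> q < 0"
proof -
  obtain e where e: "e > 0" "x + e *\<^sub>R y \<in> pos_cone a (I - J)"
    using pos_cone_perturb x(1) assms(1) by (metis finite_Diff)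
  then have "x + e *\<^sub>R y \<in> pos_cone a (I - E)"
    using x(2) y(1) by (force simp: pos_cone_def inner_add_right)
  then obtain d where d: "d > 0" "x + e *\<^sub>R y + d *\<^sub>R (- p) \<in> pos_cone a (I - E)"
    using pos_cone_perturb assms(1) by (metis finite_Diff)
  moreover have "a i \<bullet> (x + e *\<^sub>R y + d *\<^sub>R (- p)) < 0" if "i \<in> E" for i
  proof -
    have "a i \<bullet> x = 0" "a i \<bullet> y = 0" "a i \<bullet> p > 0"
      using that assms(2,3) x(2) y(2) p by (auto simp: pos_cone_def)
    with d(1) show ?thesis
      by (simp add: inner_add_right inner_diff_right)
  qed
  ultimately show ?thesis by blast
qed

section \<open>Chambers and incidence\<close>

text \<open>The orientation of each normal is left open, so that it can be adapted to a given
  chamber.\<close>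

definition normals :: "(real ^ 'n) set set \<Rightarrow> ((real ^ 'n) set \<Rightarrow> real ^ 'n) \<Rightarrow> bool" where
  "normals A a \<longleftrightarrow> (\<forall>H\<in>A. a H \<noteq> 0 \<and> H = {x. a H \<bullet> x = 0})"

lemma normalsD:
  assumes "normals A a" "H \<in> A"
  shows "a H \<noteq> 0" "x \<in> H \<longleftrightarrow> a H \<bullet> x = 0"
  using assms unfolding normals_def by blast+

section \<open>Chambers as cones of sign conditions\<close>

lemma connected_same_side:
  fixes a :: "'a::real_inner"
  assumes "connected S" "\<forall>x\<in>S. a \<bullet> x \<noteq> 0" "p \<in> S" "a \<bullet> p > 0" "x \<in> S"
  shows "a \<bullet> x > 0"
proof (rule ccontr)
  assume "\<not> a \<bullet> x > 0"
  have "connected ((\<lambda>x. a \<bullet> x) ` S)"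
    using assms(1) by (intro connected_continuous_image continuous_intros)
  then have "0 \<in> (\<lambda>x. a \<bullet> x) ` S"
    by (rule connectedD_interval[of _ "a \<bullet> x" "a \<bullet> p"])
       (use assms \<open>\<not> a \<bullet> x > 0\<close> in auto)
  with assms(2) show False by auto
qed

text \<open>The cone is convex, hence within one component; conversely no normal can change sign on
  a connected set that avoids its hyperplane.\<close>

lemma pos_cone_in_chambers:
  assumes "normals A a" "p \<in> pos_cone a A"
  shows "pos_cone a A \<in> chambers A"
proof -
  let ?C = "connected_component_set (- \<Union>A) p"
  have sub: "pos_cone a A \<subseteq> - \<Union>A"
  proof
    fix x assume x: "x \<in> pos_cone a A"
    show "x \<in> - \<Union>A"
      using x normalsD(2)[OF assms(1)] by (force simp: pos_cone_def)
  qed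
  have "pos_cone a A \<subseteq> ?C"
    using assms(2) sub convex_connected[OF convex_pos_cone]
    by (intro connected_component_maximal)
  moreover have "?C \<subseteq> pos_cone a A"
  proof
    fix x assume x: "x \<in> ?C"
    have "a H \<bullet> x > 0" if "H \<in> A" for H
    proof (rule connected_same_side[OF connected_connected_component _ _ _ x])
      show "\<forall>x\<in>?C. a H \<bullet> x \<noteq> 0"
        using connected_component_subset[of "- \<Union>A" p] normalsD(2)[OF assms(1) that] that by blast
      show "p \<in> ?C"
        using assms(2) sub by (auto simp: connected_component_refl_eq)
      show "a H \<bullet> p > 0"
        using assms(2) that by (simp add: pos_cone_def)
    qed
    then show "x \<in> pos_cone a A"
      by (simp add: pos_cone_def)
  qed
  ultimately have "pos_cone a A = ?C" by blast
  then show ?thesis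
    using assms(2) sub by (auto simp: chambers_def components_def)
qed

lemma chambers_eqI:
  assumes "c \<in> chambers A" "d \<in> chambers A" "p \<in> c" "p \<in> d"
  shows "c = d"
  using assms components_nonoverlap[of c "- \<Union>A" d] by (auto simp: chambers_def)

text \<open>Allowing any normal \<open>n\<close> of \<open>H\<close> covers the negative side too,
  by passing to the opposite normal.\<close>

lemma chamber_side:
  assumes "c \<in> chambers A" "H \<in> A" "H = {x. n \<bullet> x = 0}" "p \<in> c" "n \<bullet> p > 0" "x \<in> c"
  shows "n \<bullet> x > 0"
proof (rule connected_same_side[of c n p x])
  show "connected c"
    using assms(1) by (auto simp: chambers_def dest: in_components_connected)
  show "\<forall>x\<in>c. n \<bullet> x \<noteq> 0"
    using assms(1,2,3) in_components_subset[of c "- \<Union>A"] by (auto simp: chambers_def)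
qed (use assms in auto)

lemma normals_through:
  assumes "central_arrangement A" "p \<notin> \<Union>A"
  obtains a where "normals A a" "p \<in> pos_cone a A"
proof -
  have "\<exists>n. n \<noteq> 0 \<and> H = {x. n \<bullet> x = 0} \<and> n \<bullet> p > 0" if H: "H \<in> A" for H
  proof -
    obtain n where n: "n \<noteq> 0" "H = {x. n \<bullet> x = 0}"
      using assms(1) H unfolding central_arrangement_def linear_hyperplane_def by blast
    then have "n \<bullet> p \<noteq> 0"
      using assms(2) H by auto
    then consider "n \<bullet> p > 0" | "- n \<bullet> p > 0"
      by fastforce
    then show ?thesis
    proof cases
      case 1
      with n show ?thesis by blast
    next
      case 2
      with n show ?thesis by (intro exI[of _ "- n"]) auto
    qed
  qed
  then obtain a where "\<forall>H\<in>A. a H \<noteq> 0 \<and> H = {x. a H \<bullet> x = 0} \<and> a H \<bullet> p > 0"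
    by metis
  then show thesis
    by (intro that[of a]) (unfold normals_def pos_cone_def, blast+)
qed

lemma chamber_obtain_normals:
  assumes "central_arrangement A" "c \<in> chambers A"
  obtains a p where "normals A a" "c = pos_cone a A" "p \<in> c"
proof -
  obtain p where p: "p \<in> c"
    using assms(2) in_components_nonempty by (fastforce simp: chambers_def)
  then have "p \<notin> \<Union>A"
    using assms(2) in_components_subset[of c "- \<Union>A"] by (auto simp: chambers_def)
  then obtain a where a: "normals A a" "p \<in> pos_cone a A"
    using normals_through assms(1) by metis
  then have "c = pos_cone a A"
    using chambers_eqI[OF assms(2) pos_cone_in_chambers p] by blast
  with a p that show thesis by blast
qed

text \<open>Discarding hyperplanes discards inequalities. The definite description is justified
  because any competing chamber also contains \<open>p\<close>.\<close>

lemma localized_chamber_pos_cone: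
  assumes "normals A a" "p \<in> pos_cone a A"
  shows "localized_chamber A X (pos_cone a A) = pos_cone a (localization A X)"
proof -
  have n: "normals (localization A X) a"
    using assms(1) by (auto simp: normals_def localization_def)
  have sub: "pos_cone a A \<subseteq> pos_cone a (localization A X)"
    by (auto simp: pos_cone_def localization_def)
  have ch: "pos_cone a (localization A X) \<in> chambers (localization A X)"
    using pos_cone_in_chambers[OF n] assms(2) sub by blast
  show ?thesis
    unfolding localized_chamber_def
  proof (rule the_equality)
    show "pos_cone a (localization A X) \<in> chambers (localization A X) \<and>
        pos_cone a A \<subseteq> pos_cone a (localization A X)"
      using ch sub by blast
  next
    fix d assume "d \<in> chambers (localization A X) \<and> pos_cone a A \<subseteq> d"
    then show "d = pos_cone a (localization A X)"
      using chambers_eqI[of d _ _ p] ch assms(2) sub by blast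
  qed
qed

section \<open>Separating sets as sign patterns\<close>

text \<open>Separation is witnessed by some normal of \<open>H\<close> that need not be
  \<open>a H\<close>; this reduces it to the sign of \<open>a H\<close> at a single point of
  \<open>c'\<close>.\<close>

lemma separates_iff:
  assumes "normals A a" "p \<in> pos_cone a A" "c' \<in> chambers A" "q \<in> c'" "H \<in> A"
  shows "separates H (pos_cone a A) c' \<longleftrightarrow> a H \<bullet> q < 0"
proof
  assume "separates H (pos_cone a A) c'"
  then obtain n where n: "H = {x. n \<bullet> x = 0}" "n \<bullet> p > 0" "n \<bullet> q < 0"
    unfolding separates_def using assms by blast
  have "a H \<bullet> p > 0"
    using assms by (simp add: pos_cone_def)
  \<comment> \<open>A positive multiple of the point where the segment from \<open>p\<close> to
    \<open>q\<close> crosses \<open>H\<close>. Since \<open>a H\<close> also vanishes there, it too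
    has opposite signs at \<open>p\<close> and \<open>q\<close>.\<close>
  define r where "r = (n \<bullet> p) *\<^sub>R q - (n \<bullet> q) *\<^sub>R p"
  have "n \<bullet> r = 0"
    by (simp add: r_def inner_diff_right)
  then have "r \<in> H"
    by (simp add: n(1))
  then have "(n \<bullet> p) * (a H \<bullet> q) = (n \<bullet> q) * (a H \<bullet> p)"
    using normalsD(2)[OF assms(1,5)] by (simp add: r_def inner_diff_right)
  also have "\<dots> < 0"
    using n(3) \<open>a H \<bullet> p > 0\<close> by (simp add: mult_neg_pos)
  finally show "a H \<bullet> q < 0"
    using n(2) by (simp add: mult_less_0_iff)
next
  assume q: "a H \<bullet> q < 0"
  have H: "H = {x. a H \<bullet> x = 0}"
    using assms(1,5) by (auto simp: normals_def)
  then have "H = {x. - a H \<bullet> x = 0}"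
    by simp
  then have "- a H \<bullet> x > 0" if "x \<in> c'" for x
    using chamber_side[OF assms(3,5) _ assms(4) _ that, of "- a H"] q by simp
  then have "\<forall>x\<in>c'. a H \<bullet> x < 0"
    by simp
  moreover have "\<forall>x\<in>pos_cone a A. a H \<bullet> x > 0"
    using assms(5) by (simp add: pos_cone_def)
  ultimately show "separates H (pos_cone a A) c'"
    unfolding separates_def using H normalsD(1)[OF assms(1,5)] by blast
qed

lemma exists_chamber_separating_iff:
  assumes "central_arrangement A" "normals A a" "p \<in> pos_cone a A" "E \<subseteq> A"
  shows "(\<exists>c'\<in>chambers A. separating_set A (pos_cone a A) c' = E) \<longleftrightarrow>
    (\<exists>q\<in>pos_cone a (A - E). \<forall>H\<in>E. a H \<bullet> q < 0)"
proof
  assume "\<exists>c'\<in>chambers A. separating_set A (pos_cone a A) c' = E"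
  then obtain c' where c': "c' \<in> chambers A" "separating_set A (pos_cone a A) c' = E"
    by blast
  obtain q where q: "q \<in> c'"
    using c'(1) in_components_nonempty by (fastforce simp: chambers_def)
  have E: "E = {H\<in>A. a H \<bullet> q < 0}"
    using c'(2) separates_iff[OF assms(2,3) c'(1) q] by (auto simp: separating_set_def)
  have "q \<notin> \<Union>A"
    using c'(1) q in_components_subset[of c' "- \<Union>A"] by (auto simp: chambers_def)
  then have "\<forall>H\<in>A. a H \<bullet> q \<noteq> 0"
    using normalsD(2)[OF assms(2)] by blast
  then have "q \<in> pos_cone a (A - E)"
    by (fastforce simp: E pos_cone_def)
  then show "\<exists>q\<in>pos_cone a (A - E). \<forall>H\<in>E. a H \<bullet> q < 0"
    using E by blast
next
  assume "\<exists>q\<in>pos_cone a (A - E). \<forall>H\<in>E. a H \<bullet> q < 0"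
  then obtain q where q: "q \<in> pos_cone a (A - E)" "\<forall>H\<in>E. a H \<bullet> q < 0"
    by blast
  then have sign: "if H \<in> E then a H \<bullet> q < 0 else a H \<bullet> q > 0" if "H \<in> A" for H
    using that by (simp add: pos_cone_def)
  have "q \<notin> \<Union>A"
  proof
    assume "q \<in> \<Union>A"
    then obtain H where "H \<in> A" "a H \<bullet> q = 0"
      using normalsD(2)[OF assms(2)] by blast
    with sign[of H] show False by (simp split: if_splits)
  qed
  \<comment> \<open>Reorienting all normals to be positive at \<open>q\<close> presents the chamber
    through \<open>q\<close> as a cone.\<close>
  then obtain b where b: "normals A b" "q \<in> pos_cone b A"
    using normals_through assms(1) by metis
  have ch: "pos_cone b A \<in> chambers A"
    using pos_cone_in_chambers[OF b] .
  have "separating_set A (pos_cone a A) (pos_cone b A) = E"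
    unfolding separating_set_def using separates_iff[OF assms(2,3) ch b(2)] sign assms(4)
    by (auto split: if_splits) (meson order_less_asym)
  with ch show "\<exists>c'\<in>chambers A. separating_set A (pos_cone a A) c' = E"
    by blast
qed

section \<open>Incidence and localization\<close>

lemma intersection_subspace_eq:
  assumes "Z \<in> intersection_subspaces A"
  shows "Z = \<Inter>(localization A Z)"
  using assms by (auto simp: intersection_subspaces_def localization_def)

text \<open>The point \<open>x\<close> lies in the relative interior of a face spanning
  \<open>Z\<close>. Such a point exists because a spanning face cannot lie in a hyperplane that does
  not contain \<open>Z\<close>.\<close>

lemma incident_pos_cone_iff:
  assumes "finite A" "normals A a" "p \<in> pos_cone a A" "Z \<in> intersection_subspaces A"
  shows "incident (pos_cone a A) Z \<longleftrightarrow>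
    (\<exists>x\<in>pos_cone a (A - localization A Z). \<forall>H\<in>localization A Z. a H \<bullet> x = 0)"
proof -
  have Z: "x \<in> Z \<longleftrightarrow> (\<forall>H\<in>localization A Z. a H \<bullet> x = 0)" for x
  proof -
    have "x \<in> Z \<longleftrightarrow> (\<forall>H\<in>localization A Z. x \<in> H)"
      using intersection_subspace_eq[OF assms(4)] by blast
    also have "\<dots> \<longleftrightarrow> (\<forall>H\<in>localization A Z. a H \<bullet> x = 0)"
      using normalsD(2)[OF assms(2)] by (auto simp: localization_def)
    finally show ?thesis .
  qed
  have sub: "subspace Z"
    by (auto simp: subspace_def Z inner_add_right)
  have cl: "closure (pos_cone a A) = {x. \<forall>H\<in>A. a H \<bullet> x \<ge> 0}"
    using closure_pos_cone[OF assms(3)] .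
  show ?thesis
  proof
    assume inc: "incident (pos_cone a A) Z"
    let ?B = "A - localization A Z"
    have "\<exists>v\<in>closure (pos_cone a A) \<inter> Z. a H \<bullet> v > 0" if H: "H \<in> ?B" for H
    proof (rule ccontr)
      assume "\<not> (\<exists>v\<in>closure (pos_cone a A) \<inter> Z. a H \<bullet> v > 0)"
      then have "closure (pos_cone a A) \<inter> Z \<subseteq> {x. a H \<bullet> x = 0}"
        using H by (force simp: cl)
      then have "Z \<subseteq> {x. a H \<bullet> x = 0}"
        using inc span_minimal[OF _ subspace_hyperplane] unfolding incident_def by metis
      then have "Z \<subseteq> H"
        using normalsD(2)[OF assms(2)] H by blast
      with H show False by (simp add: localization_def)
    qed
    then obtain v where v: "\<And>H. H \<in> ?B \<Longrightarrow> v H \<in> closure (pos_cone a A) \<inter> Z \<and> a H \<bullet> v H > 0"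
      by metis
    \<comment> \<open>All summands are nonnegative on every constraint, so each strict inequality
      attained by one of them survives in the sum.\<close>
    let ?x = "\<Sum>H\<in>?B. v H"
    have "?x \<in> Z"
      using v by (intro subspace_sum[OF sub]) auto
    moreover have "a H \<bullet> ?x > 0" if H: "H \<in> ?B" for H
      unfolding inner_sum_right
    proof (rule sum_pos2[OF _ H])
      show "a H \<bullet> v K \<ge> 0" if "K \<in> ?B" for K
        using v[OF that] H by (auto simp: cl)
    qed (use v[OF H] assms(1) in auto)
    ultimately show "\<exists>x\<in>pos_cone a ?B. \<forall>H\<in>localization A Z. a H \<bullet> x = 0"
      using Z by (auto simp: pos_cone_def intro!: bexI[of _ ?x])
  next
    assume "\<exists>x\<in>pos_cone a (A - localization A Z). \<forall>H\<in>localization A Z. a H \<bullet> x = 0"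
    then obtain x where x: "x \<in> pos_cone a (A - localization A Z)" "x \<in> Z"
      using Z by blast
    have face: "w \<in> closure (pos_cone a A) \<inter> Z"
      if "w \<in> pos_cone a (A - localization A Z)" "w \<in> Z" for w
    proof -
      have "a H \<bullet> w \<ge> 0" if "H \<in> A" for H
        using that \<open>w \<in> pos_cone a _\<close> \<open>w \<in> Z\<close> Z[of w]
        by (cases "H \<in> localization A Z") (auto simp: pos_cone_def less_imp_le)
      with \<open>w \<in> Z\<close> show ?thesis by (simp add: cl)
    qed
    have "v \<in> span (closure (pos_cone a A) \<inter> Z)" if v: "v \<in> Z" for v
    proof -
      obtain e where e: "e > 0" "x + e *\<^sub>R v \<in> pos_cone a (A - localization A Z)"
        using pos_cone_perturb[OF _ x(1)] assms(1) by (metis finite_Diff)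
      have "x + e *\<^sub>R v \<in> Z"
        using x(2) v sub by (simp add: subspace_add subspace_scale)
      then have "(1 / e) *\<^sub>R ((x + e *\<^sub>R v) - x) \<in> span (closure (pos_cone a A) \<inter> Z)"
        using face x e by (intro span_scale span_diff span_base) auto
      with e(1) show ?thesis by simp
    qed
    then show "incident (pos_cone a A) Z"
      unfolding incident_def using span_minimal[OF _ sub, of "closure (pos_cone a A) \<inter> Z"]
      by auto
  qed
qed

lemma localization_localization:
  assumes "X \<subseteq> Y"
  shows "localization (localization A X) Y = localization A Y"
  using assms by (auto simp: localization_def)

text \<open>Passing to \<open>Y\<close> adds no hyperplanes: one that contains \<open>Y\<close>
  contains \<open>X\<close>, so it is in \<open>J\<close>, and it contains \<open>y\<close>, so its
  normal vanishes at \<open>y\<close>.\<close>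

lemma localization_Inter_zeros:
  fixes X :: "(real ^ 'n) set" and y :: "real ^ 'n"
  assumes "normals A a"
  defines "J \<equiv> localization A X"
  defines "Y \<equiv> \<Inter>{H\<in>J. a H \<bullet> y = 0}"
  shows "Y \<in> intersection_subspaces J" "localization A Y = {H\<in>J. a H \<bullet> y = 0}"
proof -
  show "Y \<in> intersection_subspaces J"
    by (auto simp: Y_def intersection_subspaces_def)
  have "X \<subseteq> Y"
    by (auto simp: Y_def J_def localization_def)
  have "y \<in> Y"
    using normalsD(2)[OF assms(1)] by (auto simp: Y_def J_def localization_def)
  show "localization A Y = {H\<in>J. a H \<bullet> y = 0}"
  proof
    show "localization A Y \<subseteq> {H\<in>J. a H \<bullet> y = 0}"
      using \<open>X \<subseteq> Y\<close> \<open>y \<in> Y\<close> normalsD(2)[OF assms(1)] by (auto simp: J_def localization_def)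
    show "{H\<in>J. a H \<bullet> y = 0} \<subseteq> localization A Y"
      by (auto simp: Y_def J_def localization_def)
  qed
qed

theorem theorem2p5:
  fixes A :: "(real ^ 'n) set set" and c X :: "(real ^ 'n) set"
  assumes "central_arrangement A"
    and "c \<in> chambers A"
    and "X \<in> intersection_subspaces A"
  shows "incident c X \<longleftrightarrow>
    (\<forall>Y \<in> intersection_subspaces (localization A X).
       incident (localized_chamber A X c) Y \<longrightarrow>
       (\<exists>c' \<in> chambers A. separating_set A c c' = localization A Y))"
proof -
  obtain a p where a: "normals A a" and c: "c = pos_cone a A" and p: "p \<in> pos_cone a A"
    using chamber_obtain_normals[OF assms(1,2)] by metis
  define J where "J = localization A X"
  have fin: "finite A" "finite J" and JA: "J \<subseteq> A"
    using assms(1) by (auto simp: J_def central_arrangement_def localization_def)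
  have aJ: "normals J a" and pJ: "p \<in> pos_cone a J"
    using a p JA by (auto simp: normals_def pos_cone_def)
  have incX: "incident c X \<longleftrightarrow> (\<exists>x\<in>pos_cone a (A - J). \<forall>H\<in>J. a H \<bullet> x = 0)"
    unfolding c J_def by (rule incident_pos_cone_iff[OF fin(1) a p assms(3)])
  have incY: "incident (localized_chamber A X c) Y \<longleftrightarrow>
      (\<exists>y\<in>pos_cone a (J - localization A Y). \<forall>H\<in>localization A Y. a H \<bullet> y = 0)"
    and subJ: "localization A Y \<subseteq> J"
    if Y: "Y \<in> intersection_subspaces J" for Y
  proof -
    have "X \<subseteq> Y"
      using Y by (auto simp: J_def intersection_subspaces_def localization_def)
    then have "localization J Y = localization A Y"
      unfolding J_def by (rule localization_localization)
    then show "incident (localized_chamber A X c) Y \<longleftrightarrow>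
        (\<exists>y\<in>pos_cone a (J - localization A Y). \<forall>H\<in>localization A Y. a H \<bullet> y = 0)"
      unfolding c localized_chamber_pos_cone[OF a p] J_def[symmetric]
      using incident_pos_cone_iff[OF fin(2) aJ pJ Y] by simp
    show "localization A Y \<subseteq> J"
      using \<open>X \<subseteq> Y\<close> by (auto simp: J_def localization_def)
  qed
  have sep: "(\<exists>c'\<in>chambers A. separating_set A c c' = E) \<longleftrightarrow>
      (\<exists>q\<in>pos_cone a (A - E). \<forall>H\<in>E. a H \<bullet> q < 0)" if "E \<subseteq> J" for E
    unfolding c using exists_chamber_separating_iff[OF assms(1) a p] that JA by blast
  show ?thesis
    unfolding J_def[symmetric]
  proof (intro iffI ballI impI)
    fix Y
    assume "incident c X" and Y: "Y \<in> intersection_subspaces J"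
      and "incident (localized_chamber A X c) Y"
    then show "\<exists>c'\<in>chambers A. separating_set A c c' = localization A Y"
      unfolding sep[OF subJ[OF Y]] incY[OF Y] incX
      using opposite_point[OF fin(1) JA subJ[OF Y] p] by blast
  next
    assume chambers: "\<forall>Y\<in>intersection_subspaces J. incident (localized_chamber A X c) Y \<longrightarrow>
      (\<exists>c'\<in>chambers A. separating_set A c c' = localization A Y)"
    have opposite: "\<exists>q\<in>pos_cone a (A - {H\<in>J. a H \<bullet> y = 0}). \<forall>H\<in>J. a H \<bullet> y = 0 \<longrightarrow> a H \<bullet> q < 0"
      if y: "\<forall>H\<in>J. a H \<bullet> y \<ge> 0" for y
    proof -
      \<comment> \<open>The span of the face of the localized chamber whose relative interior
        contains \<open>y\<close>; the chamber hypothesis is applied to it.\<close>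
      define Y where "Y = \<Inter>{H\<in>J. a H \<bullet> y = 0}"
      have Y: "Y \<in> intersection_subspaces J" and zeros: "localization A Y = {H\<in>J. a H \<bullet> y = 0}"
        using localization_Inter_zeros[OF a] unfolding Y_def J_def by blast+
      have "y \<in> pos_cone a (J - localization A Y)" "\<forall>H\<in>localization A Y. a H \<bullet> y = 0"
        using y by (auto simp: zeros pos_cone_def order_less_le)
      then have "\<exists>q\<in>pos_cone a (A - localization A Y). \<forall>H\<in>localization A Y. a H \<bullet> q < 0"
        using chambers Y incY[OF Y] sep[OF subJ[OF Y]] by blast
      then show ?thesis
        unfolding zeros by blast
    qed
    then show "incident c X"
      \<comment> \<open>At \<open>y = 0\<close> every constraint of \<open>J\<close> vanishes, so
        the smallest face is reached and the generic point is one of \<open>X\<close>.\<close>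
      unfolding incX using generic_face_point[OF fin(1) JA opposite, where y = 0] by simp
  qed
qed

end
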